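(* Let $\mathcal{C}$ be a finitary extensive category. The extensive topology on $\mathcal{C}$ is subcanonical, i.e. for every object $W$ of $\mathcal{C}$ the representable presheaf $\operatorname{Hom}_{\mathcal{C}}(-,W)$ is a sheaf for the extensive topology.
   Context: A category is finitary extensive if it has finite coproducts, it has pullbacks along coprojections of finite coproducts, and for every commutative diagram with top row $Z_1\to Z\leftarrow Z_2$, bottom row the coprojections $X\to X\coprod Y\leftarrow Y$, and vertical maps $Z_1\to X$, $Z\to X\coprod Y$, $Z_2\to Y$, both squares are pullbacks if and only if the top row is a coproduct diagram. The extensive topology on a finitary extensive category is the smallest Grothendieck topology in which, for each finite family $(X_i\to X)_{i\in I}$ exhibiting $X$ as a coproduct of $(X_i)_{i\in I}$, the sieve generated by the family is a covering sieve. *)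

theory Defs
  imports Main
begin

section \<open>Categories\<close>

record ('o, 'a) cat =
  Obj :: "'o set"
  Arr :: "'a set"
  Dom :: "'a \<Rightarrow> 'o"
  Cod :: "'a \<Rightarrow> 'o"
  Id :: "'o \<Rightarrow> 'a"
  Comp :: "'a \<Rightarrow> 'a \<Rightarrow> 'a" (infixl "\<cdot>\<index>" 75)

text \<open>Composition is written in the usual order: \<open>g \<cdot>\<^bsub>C\<^esub> f\<close> is meaningful when
  \<open>Cod C f = Dom C g\<close>. Nothing is assumed about values outside \<open>Obj C\<close>, \<open>Arr C\<close> or about
  non-composable pairs.\<close>

definition Hom :: "('o, 'a) cat \<Rightarrow> 'o \<Rightarrow> 'o \<Rightarrow> 'a set" where
  "Hom C X Y = {f \<in> Arr C. Dom C f = X \<and> Cod C f = Y}"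

locale category =
  fixes C :: "('o, 'a) cat" (structure)
  assumes dom_closed: "f \<in> Arr C \<Longrightarrow> Dom C f \<in> Obj C"
    and cod_closed: "f \<in> Arr C \<Longrightarrow> Cod C f \<in> Obj C"
    and id_closed: "X \<in> Obj C \<Longrightarrow> Id C X \<in> Hom C X X"
    and comp_closed: "f \<in> Hom C X Y \<Longrightarrow> g \<in> Hom C Y Z \<Longrightarrow> g \<cdot> f \<in> Hom C X Z"
    and id_left: "f \<in> Hom C X Y \<Longrightarrow> Id C Y \<cdot> f = f"
    and id_right: "f \<in> Hom C X Y \<Longrightarrow> f \<cdot> Id C X = f"
    and comp_assoc: "f \<in> Hom C X Y \<Longrightarrow> g \<in> Hom C Y Z \<Longrightarrow> h \<in> Hom C Z V \<Longrightarrow>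
      (h \<cdot> g) \<cdot> f = h \<cdot> (g \<cdot> f)"

section \<open>Coproducts and pullbacks\<close>

definition is_coproduct ::
  "('o, 'a) cat \<Rightarrow> 'i set \<Rightarrow> ('i \<Rightarrow> 'o) \<Rightarrow> 'o \<Rightarrow> ('i \<Rightarrow> 'a) \<Rightarrow> bool" where
  "is_coproduct C I A X x \<longleftrightarrow>
     X \<in> Obj C \<and> (\<forall>i\<in>I. A i \<in> Obj C \<and> x i \<in> Hom C (A i) X) \<and>
     (\<forall>Y\<in>Obj C. \<forall>t. (\<forall>i\<in>I. t i \<in> Hom C (A i) Y) \<longrightarrow>
        (\<exists>!h. h \<in> Hom C X Y \<and> (\<forall>i\<in>I. h \<cdot>\<^bsub>C\<^esub> x i = t i)))"

definition is_binary_coproduct ::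
  "('o, 'a) cat \<Rightarrow> 'o \<Rightarrow> 'o \<Rightarrow> 'o \<Rightarrow> 'a \<Rightarrow> 'a \<Rightarrow> bool" where
  "is_binary_coproduct C X Y P i j \<longleftrightarrow>
     is_coproduct C (UNIV :: bool set) (case_bool X Y) P (case_bool i j)"

lemma is_binary_coproduct_iff:
  fixes C :: "('o, 'a) cat"
  shows "is_binary_coproduct C X Y P i j \<longleftrightarrow>
     X \<in> Obj C \<and> Y \<in> Obj C \<and> P \<in> Obj C \<and> i \<in> Hom C X P \<and> j \<in> Hom C Y P \<and>
     (\<forall>Q\<in>Obj C. \<forall>f\<in>Hom C X Q. \<forall>g\<in>Hom C Y Q.
        \<exists>!h. h \<in> Hom C P Q \<and> h \<cdot>\<^bsub>C\<^esub> i = f \<and> h \<cdot>\<^bsub>C\<^esub> j = g)"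
proof -
  have all_t: "(\<forall>t. t True \<in> A \<and> t False \<in> B \<longrightarrow> R (t True) (t False)) \<longleftrightarrow> (\<forall>f\<in>A. \<forall>g\<in>B. R f g)"
    for A B :: "'a set" and R
  proof
    assume L: "\<forall>t. t True \<in> A \<and> t False \<in> B \<longrightarrow> R (t True) (t False)"
    show "\<forall>f\<in>A. \<forall>g\<in>B. R f g"
    proof (intro ballI)
      fix f g assume "f \<in> A" "g \<in> B"
      then show "R f g" using L[rule_format, of "case_bool f g"] by simp
    qed
  qed simp
  have all_b: "(\<forall>b\<in>UNIV. R b) \<longleftrightarrow> R True \<and> R False" for R :: "bool \<Rightarrow> bool"
    by (metis (full_types) UNIV_I)
  show ?thesis
    unfolding is_binary_coproduct_def is_coproduct_def all_b bool.case
      all_t[of _ _ "\<lambda>f g. \<exists>!h. h \<in> Hom C P Q \<and> h \<cdot>\<^bsub>C\<^esub> i = f \<and> h \<cdot>\<^bsub>C\<^esub> j = g" for Q]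
    by (simp only: conj_ac)
qed

text \<open>\<open>is_pullback C p q f g\<close>: the square with \<open>f \<cdot> p = g \<cdot> q\<close> is a pullback of \<open>f\<close>
  along \<open>g\<close>.\<close>

definition is_pullback :: "('o, 'a) cat \<Rightarrow> 'a \<Rightarrow> 'a \<Rightarrow> 'a \<Rightarrow> 'a \<Rightarrow> bool" where
  "is_pullback C p q f g \<longleftrightarrow>
     p \<in> Arr C \<and> q \<in> Arr C \<and> f \<in> Arr C \<and> g \<in> Arr C \<and>
     Dom C p = Dom C q \<and> Cod C p = Dom C f \<and> Cod C q = Dom C g \<and> Cod C f = Cod C g \<and>
     f \<cdot>\<^bsub>C\<^esub> p = g \<cdot>\<^bsub>C\<^esub> q \<and>
     (\<forall>T\<in>Obj C. \<forall>a\<in>Hom C T (Dom C f). \<forall>b\<in>Hom C T (Dom C g). f \<cdot>\<^bsub>C\<^esub> a = g \<cdot>\<^bsub>C\<^esub> b \<longrightarrow>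
        (\<exists>!h. h \<in> Hom C T (Dom C p) \<and> p \<cdot>\<^bsub>C\<^esub> h = a \<and> q \<cdot>\<^bsub>C\<^esub> h = b))"

section \<open>Finitary extensive categories\<close>

text \<open>Finite families are indexed by finite sets of natural numbers; up to reindexing these are
  all finite families, the empty one included.\<close>

locale finitary_extensive = category C for C :: "('o, 'a) cat" (structure) +
  assumes finite_coproducts:
      "\<And>(I :: nat set) A. finite I \<Longrightarrow> (\<forall>i\<in>I. A i \<in> Obj C) \<Longrightarrow> \<exists>X x. is_coproduct C I A X x"
    and pullbacks_along_coprojections:
      "\<And>(I :: nat set) A X x i f. finite I \<Longrightarrow> is_coproduct C I A X x \<Longrightarrow> i \<in> I \<Longrightarrow>
         f \<in> Arr C \<Longrightarrow> Cod C f = X \<Longrightarrow> \<exists>p q. is_pullback C p q f (x i)"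
    and extensive:
      "\<And>X Y P i j Z1 Z Z2 z1 z2 f1 f f2.
         is_binary_coproduct C X Y P i j \<Longrightarrow>
         z1 \<in> Hom C Z1 Z \<Longrightarrow> z2 \<in> Hom C Z2 Z \<Longrightarrow>
         f1 \<in> Hom C Z1 X \<Longrightarrow> f \<in> Hom C Z P \<Longrightarrow> f2 \<in> Hom C Z2 Y \<Longrightarrow>
         f \<cdot> z1 = i \<cdot> f1 \<Longrightarrow> f \<cdot> z2 = j \<cdot> f2 \<Longrightarrow>
         is_pullback C z1 f1 f i \<and> is_pullback C z2 f2 f j \<longleftrightarrow>
         is_binary_coproduct C Z1 Z2 Z z1 z2"

section \<open>Grothendieck topologies\<close>

definition is_sieve :: "('o, 'a) cat \<Rightarrow> 'o \<Rightarrow> 'a set \<Rightarrow> bool" where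
  "is_sieve C X S \<longleftrightarrow>
     X \<in> Obj C \<and> S \<subseteq> {f \<in> Arr C. Cod C f = X} \<and>
     (\<forall>f\<in>S. \<forall>g\<in>Arr C. Cod C g = Dom C f \<longrightarrow> f \<cdot>\<^bsub>C\<^esub> g \<in> S)"

definition max_sieve :: "('o, 'a) cat \<Rightarrow> 'o \<Rightarrow> 'a set" where
  "max_sieve C X = {f \<in> Arr C. Cod C f = X}"

definition pullback_sieve :: "('o, 'a) cat \<Rightarrow> 'a \<Rightarrow> 'a set \<Rightarrow> 'a set" where
  "pullback_sieve C f S = {g \<in> Arr C. Cod C g = Dom C f \<and> f \<cdot>\<^bsub>C\<^esub> g \<in> S}"

definition generated_sieve :: "('o, 'a) cat \<Rightarrow> 'i set \<Rightarrow> ('i \<Rightarrow> 'a) \<Rightarrow> 'a set" where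
  "generated_sieve C I x = {x i \<cdot>\<^bsub>C\<^esub> g | i g. i \<in> I \<and> g \<in> Arr C \<and> Cod C g = Dom C (x i)}"

text \<open>\<open>J X\<close> is the set of covering sieves on \<open>X\<close>; it is empty when \<open>X\<close> is not an object.\<close>

definition is_grothendieck_topology :: "('o, 'a) cat \<Rightarrow> ('o \<Rightarrow> 'a set set) \<Rightarrow> bool" where
  "is_grothendieck_topology C J \<longleftrightarrow>
     (\<forall>X. \<forall>S\<in>J X. is_sieve C X S) \<and>
     (\<forall>X\<in>Obj C. max_sieve C X \<in> J X) \<and>
     (\<forall>f\<in>Arr C. \<forall>S\<in>J (Cod C f). pullback_sieve C f S \<in> J (Dom C f)) \<and>
     (\<forall>X. \<forall>S\<in>J X. \<forall>R. is_sieve C X R \<and> (\<forall>f\<in>S. pullback_sieve C f R \<in> J (Dom C f)) \<longrightarrow> R \<in> J X)"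

definition covers_finite_coproducts :: "('o, 'a) cat \<Rightarrow> ('o \<Rightarrow> 'a set set) \<Rightarrow> bool" where
  "covers_finite_coproducts C J \<longleftrightarrow>
     (\<forall>(I :: nat set) A X x. finite I \<and> is_coproduct C I A X x \<longrightarrow> generated_sieve C I x \<in> J X)"

text \<open>The smallest such topology, constructed as an intersection; that it is indeed the least one
  is \<open>category.extensive_topology_least\<close> below.\<close>

definition extensive_topology :: "('o, 'a) cat \<Rightarrow> 'o \<Rightarrow> 'a set set" where
  "extensive_topology C X =
     \<Inter> {J X | J. is_grothendieck_topology C J \<and> covers_finite_coproducts C J}"

context category
begin

lemma is_sieve_pullback_sieve:
  assumes "f \<in> Arr C" "is_sieve C (Cod C f) S"
  shows "is_sieve C (Dom C f) (pullback_sieve C f S)"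
proof -
  have "f \<cdot> (g \<cdot> h) \<in> S \<and> g \<cdot> h \<in> Hom C (Dom C h) (Dom C f)"
    if "g \<in> Arr C" "Cod C g = Dom C f" "f \<cdot> g \<in> S" "h \<in> Arr C" "Cod C h = Dom C g" for g h
  proof -
    have g: "g \<in> Hom C (Dom C g) (Dom C f)" and h: "h \<in> Hom C (Dom C h) (Dom C g)"
      and f: "f \<in> Hom C (Dom C f) (Cod C f)"
      using that assms by (auto simp: Hom_def)
    have "Dom C (f \<cdot> g) = Dom C g" using comp_closed[OF g f] by (simp add: Hom_def)
    then have "(f \<cdot> g) \<cdot> h \<in> S" using assms(2) that by (auto simp: is_sieve_def)
    then show ?thesis using comp_assoc[OF h g f] comp_closed[OF h g] by simp
  qed
  then show ?thesis
    using assms dom_closed unfolding is_sieve_def pullback_sieve_def Hom_def by auto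
qed

lemma is_sieve_max_sieve:
  assumes "X \<in> Obj C" shows "is_sieve C X (max_sieve C X)"
proof -
  have "f \<cdot> g \<in> Hom C (Dom C g) (Cod C f)"
    if "f \<in> Arr C" "g \<in> Arr C" "Cod C g = Dom C f" for f g
    using that by (intro comp_closed[of g _ "Dom C f"]) (auto simp: Hom_def)
  then show ?thesis using assms by (auto simp: is_sieve_def max_sieve_def Hom_def)
qed

lemma is_sieve_generated_sieve:
  assumes "X \<in> Obj C" "\<forall>i\<in>I. x i \<in> Arr C \<and> Cod C (x i) = X"
  shows "is_sieve C X (generated_sieve C I x)"
proof -
  have *: "x i \<cdot> g \<in> Hom C (Dom C g) X \<and>
      (\<forall>h\<in>Arr C. Cod C h = Dom C g \<longrightarrow> (x i \<cdot> g) \<cdot> h = x i \<cdot> (g \<cdot> h) \<and>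
        g \<cdot> h \<in> Hom C (Dom C h) (Dom C (x i)))"
    if "i \<in> I" "g \<in> Arr C" "Cod C g = Dom C (x i)" for i g
  proof -
    have g: "g \<in> Hom C (Dom C g) (Dom C (x i))" and x: "x i \<in> Hom C (Dom C (x i)) X"
      using that assms by (auto simp: Hom_def)
    have "(x i \<cdot> g) \<cdot> h = x i \<cdot> (g \<cdot> h) \<and> g \<cdot> h \<in> Hom C (Dom C h) (Dom C (x i))"
      if "h \<in> Arr C" "Cod C h = Dom C g" for h
    proof -
      have h: "h \<in> Hom C (Dom C h) (Dom C g)" using that by (auto simp: Hom_def)
      show ?thesis using comp_assoc[OF h g x] comp_closed[OF h g] by simp
    qed
    then show ?thesis using comp_closed[OF g x] by simp
  qed
  show ?thesis
    unfolding is_sieve_def generated_sieve_def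
  proof (intro conjI ballI impI)
    show "{x i \<cdot> g |i g. i \<in> I \<and> g \<in> Arr C \<and> Cod C g = Dom C (x i)}
        \<subseteq> {f \<in> Arr C. Cod C f = X}"
      using * by (auto simp: Hom_def)
  next
    fix f h
    assume "f \<in> {x i \<cdot> g |i g. i \<in> I \<and> g \<in> Arr C \<and> Cod C g = Dom C (x i)}"
      and h: "h \<in> Arr C" "Cod C h = Dom C f"
    then obtain i g where f: "f = x i \<cdot> g" "i \<in> I" "g \<in> Arr C" "Cod C g = Dom C (x i)" by auto
    then have "Dom C f = Dom C g" using * by (auto simp: Hom_def)
    then have "f \<cdot> h = x i \<cdot> (g \<cdot> h) \<and> g \<cdot> h \<in> Hom C (Dom C h) (Dom C (x i))"
      using *[OF f(2-4)] f h by auto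
    then show "f \<cdot> h \<in> {x i \<cdot> g |i g. i \<in> I \<and> g \<in> Arr C \<and> Cod C g = Dom C (x i)}"
      using f(2) by (auto simp: Hom_def)
  qed (use assms in auto)
qed

lemma discrete_topology:
  "is_grothendieck_topology C (\<lambda>X. {S. is_sieve C X S})"
  "covers_finite_coproducts C (\<lambda>X. {S. is_sieve C X S})"
proof -
  show "is_grothendieck_topology C (\<lambda>X. {S. is_sieve C X S})"
    unfolding is_grothendieck_topology_def
    by (simp add: is_sieve_max_sieve is_sieve_pullback_sieve)
  show "covers_finite_coproducts C (\<lambda>X. {S. is_sieve C X S})"
    unfolding covers_finite_coproducts_def mem_Collect_eq
  proof (intro allI impI)
    fix I :: "nat set" and A X x
    assume "finite I \<and> is_coproduct C I A X x"
    then have "X \<in> Obj C" "\<forall>i\<in>I. x i \<in> Arr C \<and> Cod C (x i) = X"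
      by (simp_all add: is_coproduct_def Hom_def)
    then show "is_sieve C X (generated_sieve C I x)" by (rule is_sieve_generated_sieve)
  qed
qed

theorem extensive_topology_least:
  shows "is_grothendieck_topology C (extensive_topology C)"
    and "covers_finite_coproducts C (extensive_topology C)"
    and "\<lbrakk>is_grothendieck_topology C J; covers_finite_coproducts C J\<rbrakk> \<Longrightarrow>
           extensive_topology C X \<subseteq> J X"
proof -
  let ?P = "\<lambda>J. is_grothendieck_topology C J \<and> covers_finite_coproducts C J"
  have mem: "S \<in> extensive_topology C X \<longleftrightarrow> (\<forall>J. ?P J \<longrightarrow> S \<in> J X)" for S X
    by (auto simp: extensive_topology_def)
  have sieve: "is_sieve C X S" if "S \<in> extensive_topology C X" for S X
  proof -
    have "?P J \<longrightarrow> S \<in> J X" for J using that mem by simp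
    from this[of "\<lambda>X. {S. is_sieve C X S}"] show ?thesis using discrete_topology by simp
  qed
  show "is_grothendieck_topology C (extensive_topology C)"
    unfolding is_grothendieck_topology_def
  proof (intro conjI allI ballI impI)
    fix X S R
    assume S: "S \<in> extensive_topology C X"
      and R: "is_sieve C X R \<and> (\<forall>f\<in>S. pullback_sieve C f R \<in> extensive_topology C (Dom C f))"
    show "R \<in> extensive_topology C X"
      unfolding mem
    proof (intro allI impI)
      fix J assume J: "?P J"
      then have "S \<in> J X" "\<forall>f\<in>S. pullback_sieve C f R \<in> J (Dom C f)"
        using S R by (auto simp: mem)
      moreover have "is_sieve C X R" using R by (rule conjunct1)
      ultimately show "R \<in> J X"
        using J[THEN conjunct1, unfolded is_grothendieck_topology_def, THEN conjunct2,
            THEN conjunct2, THEN conjunct2, THEN spec[of _ X], THEN bspec[of _ _ S],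
            THEN spec[of _ R]]
        by simp
    qed
  next
    show "is_sieve C X S" if "S \<in> extensive_topology C X" for X S
      using that by (rule sieve)
    show "max_sieve C X \<in> extensive_topology C X" if "X \<in> Obj C" for X
      unfolding mem
    proof (intro allI impI)
      fix J assume "?P J"
      then show "max_sieve C X \<in> J X"
        using that unfolding is_grothendieck_topology_def by (elim conjE) (rule bspec)
    qed
    show "pullback_sieve C f S \<in> extensive_topology C (Dom C f)"
      if "f \<in> Arr C" "S \<in> extensive_topology C (Cod C f)" for f S
      unfolding mem
    proof (intro allI impI)
      fix J assume J: "?P J"
      then have "S \<in> J (Cod C f)" using that(2) by (simp add: mem)
      then show "pullback_sieve C f S \<in> J (Dom C f)"
        using J[THEN conjunct1, unfolded is_grothendieck_topology_def, THEN conjunct2,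
            THEN conjunct2, THEN conjunct1] that(1)
        by blast
    qed
  qed
  show "covers_finite_coproducts C (extensive_topology C)"
    unfolding covers_finite_coproducts_def[of C "extensive_topology C"] mem
    by (simp only: covers_finite_coproducts_def) blast
  show "\<lbrakk>is_grothendieck_topology C J; covers_finite_coproducts C J\<rbrakk> \<Longrightarrow>
      extensive_topology C X \<subseteq> J X"
    by (auto simp: mem)
qed

end

section \<open>Sheaves\<close>

text \<open>A presheaf of sets on \<open>C\<close>: \<open>Sec F X\<close> is the set \<open>F(X)\<close>, and \<open>Res F f\<close> is the restriction
  map \<open>F(Cod f) \<rightarrow> F(Dom f)\<close>, whose values outside \<open>F(Cod f)\<close> are irrelevant.\<close>

record ('o, 'a, 'v) psh =
  Sec :: "'o \<Rightarrow> 'v set"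
  Res :: "'a \<Rightarrow> 'v \<Rightarrow> 'v"

definition is_presheaf :: "('o, 'a) cat \<Rightarrow> ('o, 'a, 'v) psh \<Rightarrow> bool" where
  "is_presheaf C F \<longleftrightarrow>
     (\<forall>f\<in>Arr C. \<forall>s\<in>Sec F (Cod C f). Res F f s \<in> Sec F (Dom C f)) \<and>
     (\<forall>X\<in>Obj C. \<forall>s\<in>Sec F X. Res F (Id C X) s = s) \<and>
     (\<forall>f\<in>Arr C. \<forall>g\<in>Arr C. Cod C g = Dom C f \<longrightarrow>
        (\<forall>s\<in>Sec F (Cod C f). Res F (f \<cdot>\<^bsub>C\<^esub> g) s = Res F g (Res F f s)))"

definition is_matching_family ::
  "('o, 'a) cat \<Rightarrow> ('o, 'a, 'v) psh \<Rightarrow> 'a set \<Rightarrow> ('a \<Rightarrow> 'v) \<Rightarrow> bool" where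
  "is_matching_family C F S s \<longleftrightarrow>
     (\<forall>f\<in>S. s f \<in> Sec F (Dom C f)) \<and>
     (\<forall>f\<in>S. \<forall>g\<in>Arr C. Cod C g = Dom C f \<longrightarrow> Res F g (s f) = s (f \<cdot>\<^bsub>C\<^esub> g))"

definition is_sheaf :: "('o, 'a) cat \<Rightarrow> ('o \<Rightarrow> 'a set set) \<Rightarrow> ('o, 'a, 'v) psh \<Rightarrow> bool" where
  "is_sheaf C J F \<longleftrightarrow>
     is_presheaf C F \<and>
     (\<forall>X\<in>Obj C. \<forall>S\<in>J X. \<forall>s. is_matching_family C F S s \<longrightarrow>
        (\<exists>!t. t \<in> Sec F X \<and> (\<forall>f\<in>S. Res F f t = s f)))"

definition representable :: "('o, 'a) cat \<Rightarrow> 'o \<Rightarrow> ('o, 'a, 'a) psh" where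
  "representable C W = \<lparr>Sec = (\<lambda>X. Hom C X W), Res = (\<lambda>f h. h \<cdot>\<^bsub>C\<^esub> f)\<rparr>"

definition subcanonical :: "('o, 'a) cat \<Rightarrow> ('o \<Rightarrow> 'a set set) \<Rightarrow> bool" where
  "subcanonical C J \<longleftrightarrow> (\<forall>W\<in>Obj C. is_sheaf C J (representable C W))"

end

theory Submission
  imports Defs
begin

text \<open>
  Call a sieve \<^emph>\<open>large\<close> if it contains all coprojections of some finite coproduct. The proof rests
  on one consequence of extensivity: finite coproducts are universal. Given a finite coproduct
  \<open>x i : A i \<rightarrow> X\<close> and any \<open>f : Y \<rightarrow> X\<close>, the object \<open>Y\<close> is itself the coproduct of a family
  \<open>y i : B i \<rightarrow> Y\<close> such that each \<open>f \<cdot> y i\<close> factors through \<open>x i\<close>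
  (\<open>finite_coproducts_universal\<close>).

  Universality makes large sieves stable under pullback. As a coproduct of coproducts is again
  a coproduct, they are also closed under the local character axiom, so the large sieves form a
  Grothendieck topology (\<open>large_sieves_topology\<close>). It contains the sieves generated by finite
  coproducts, and hence every sieve of the extensive topology is large.

  It remains to glue a matching family \<open>s\<close> of maps into \<open>W\<close> over a large sieve \<open>S\<close> on \<open>X\<close>
  (\<open>large_sieve_unique_gluing\<close>). The coproduct \<open>x i : A i \<rightarrow> X\<close> contained in \<open>S\<close> leaves exactly
  one candidate, the map \<open>t : X \<rightarrow> W\<close> with \<open>t \<cdot> x i = s (x i)\<close>. For an arbitrary \<open>f\<close> in \<open>S\<close> the
  equation \<open>t \<cdot> f = s f\<close> can be checked after splitting the domain of \<open>f\<close> by universality, and on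
  each summand it holds because \<open>f\<close> factors there through some \<open>x i\<close>.
\<close>

section \<open>Coproducts in a category\<close>

context category
begin

lemma coproduct_ext:
  assumes "is_coproduct C I A X x" "h \<in> Hom C X Y" "k \<in> Hom C X Y"
    and "\<And>i. i \<in> I \<Longrightarrow> h \<cdot> x i = k \<cdot> x i"
  shows "h = k"
proof -
  have Y: "Y \<in> Obj C" using assms(2) cod_closed by (auto simp: Hom_def)
  have t: "\<forall>i\<in>I. k \<cdot> x i \<in> Hom C (A i) Y"
    using assms(1,3) comp_closed by (auto simp: is_coproduct_def)
  have "\<exists>!h. h \<in> Hom C X Y \<and> (\<forall>i\<in>I. h \<cdot> x i = k \<cdot> x i)"
    using assms(1) Y t unfolding is_coproduct_def
    by (elim conjE) (drule bspec[of _ _ Y], assumption, drule spec[of _ "\<lambda>i. k \<cdot> x i"], simp)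
  then show ?thesis using assms(2-4) by blast
qed

lemma coproduct_factor:
  assumes "is_coproduct C I A X x" "Y \<in> Obj C" "\<And>i. i \<in> I \<Longrightarrow> t i \<in> Hom C (A i) Y"
  obtains h where "h \<in> Hom C X Y" "\<And>i. i \<in> I \<Longrightarrow> h \<cdot> x i = t i"
proof -
  have "\<exists>!h. h \<in> Hom C X Y \<and> (\<forall>i\<in>I. h \<cdot> x i = t i)"
    using assms unfolding is_coproduct_def by auto
  then show ?thesis using that by blast
qed

lemma is_coproductI:
  assumes "X \<in> Obj C" "\<And>i. i \<in> I \<Longrightarrow> x i \<in> Hom C (A i) X"
    and "\<And>Y t. Y \<in> Obj C \<Longrightarrow> (\<And>i. i \<in> I \<Longrightarrow> t i \<in> Hom C (A i) Y) \<Longrightarrow>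
           \<exists>h\<in>Hom C X Y. \<forall>i\<in>I. h \<cdot> x i = t i"
    and "\<And>Y h k. h \<in> Hom C X Y \<Longrightarrow> k \<in> Hom C X Y \<Longrightarrow> (\<And>i. i \<in> I \<Longrightarrow> h \<cdot> x i = k \<cdot> x i) \<Longrightarrow> h = k"
  shows "is_coproduct C I A X x"
  unfolding is_coproduct_def
proof (intro conjI ballI allI impI)
  show "A i \<in> Obj C" if "i \<in> I" for i
    using dom_closed[of "x i"] assms(2)[OF that] by (simp add: Hom_def)
  fix Y t assume Y: "Y \<in> Obj C" and t: "\<forall>i\<in>I. t i \<in> Hom C (A i) Y"
  from assms(3)[OF Y, of t] t obtain h where h: "h \<in> Hom C X Y" "\<forall>i\<in>I. h \<cdot> x i = t i"
    by auto
  show "\<exists>!h. h \<in> Hom C X Y \<and> (\<forall>i\<in>I. h \<cdot> x i = t i)"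
  proof (intro ex1I[of _ h] conjI)
    fix k assume "k \<in> Hom C X Y \<and> (\<forall>i\<in>I. k \<cdot> x i = t i)"
    then show "k = h" using h assms(4)[of k Y h] by auto
  qed (use h in auto)
qed (use assms in auto)

lemma coproduct_reindex:
  assumes "is_coproduct C I A X x" "bij_betw e K I"
  shows "is_coproduct C K (A \<circ> e) X (x \<circ> e)"
proof (rule is_coproductI)
  have eI: "e k \<in> I" if "k \<in> K" for k using assms(2) that by (rule bij_betwE[THEN bspec])
  show "X \<in> Obj C" using assms(1) by (simp add: is_coproduct_def)
  show "(x \<circ> e) k \<in> Hom C ((A \<circ> e) k) X" if "k \<in> K" for k
    using assms(1) eI[OF that] by (simp add: is_coproduct_def)
  let ?d = "inv_into K e"
  have d: "?d i \<in> K" "e (?d i) = i" if "i \<in> I" for i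
    using assms(2) that by (auto simp: bij_betw_def inv_into_into f_inv_into_f)
  have de: "?d (e k) = k" if "k \<in> K" for k
    using assms(2) that by (auto simp: bij_betw_def)
  show "\<exists>h\<in>Hom C X Y. \<forall>k\<in>K. h \<cdot> (x \<circ> e) k = t k"
    if Y: "Y \<in> Obj C" and t: "\<And>k. k \<in> K \<Longrightarrow> t k \<in> Hom C ((A \<circ> e) k) Y" for Y t
  proof -
    have "t (?d i) \<in> Hom C (A i) Y" if "i \<in> I" for i using t[of "?d i"] d[OF that] by simp
    from coproduct_factor[OF assms(1) Y this]
    obtain h where "h \<in> Hom C X Y" "\<And>i. i \<in> I \<Longrightarrow> h \<cdot> x i = t (?d i)" by blast
    then show ?thesis using eI de by (intro bexI[of _ h]) auto
  qed
  show "h = k" if "h \<in> Hom C X Y" "k \<in> Hom C X Y"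
    "\<And>j. j \<in> K \<Longrightarrow> h \<cdot> (x \<circ> e) j = k \<cdot> (x \<circ> e) j" for Y h k
    using coproduct_ext[OF assms(1) that(1,2)] that(3) d by (metis comp_apply)
qed

lemma coproduct_of_coproducts:
  assumes X: "is_coproduct C I A X x"
    and B: "\<And>i. i \<in> I \<Longrightarrow> is_coproduct C (K i) (B i) (A i) (y i)"
  shows "is_coproduct C (Sigma I K) (\<lambda>(i, j). B i j) X (\<lambda>(i, j). x i \<cdot> y i j)"
proof (rule is_coproductI)
  have x: "x i \<in> Hom C (A i) X" if "i \<in> I" for i using X that by (simp add: is_coproduct_def)
  have y: "y i j \<in> Hom C (B i j) (A i)" if "i \<in> I" "j \<in> K i" for i j
    using B[OF that(1)] that(2) by (simp add: is_coproduct_def)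
  show "X \<in> Obj C" using X by (simp add: is_coproduct_def)
  show "(case p of (i, j) \<Rightarrow> x i \<cdot> y i j) \<in> Hom C (case p of (i, j) \<Rightarrow> B i j) X"
    if pS: "p \<in> Sigma I K" for p
  proof -
    obtain i j where p: "p = (i, j)" "i \<in> I" "j \<in> K i" using pS by blast
    show ?thesis unfolding p prod.case by (rule comp_closed[OF y[OF p(2,3)] x[OF p(2)]])
  qed
  show "\<exists>h\<in>Hom C X Y. \<forall>p\<in>Sigma I K. h \<cdot> (case p of (i, j) \<Rightarrow> x i \<cdot> y i j) = t p"
    if Y: "Y \<in> Obj C" and t: "\<And>p. p \<in> Sigma I K \<Longrightarrow> t p \<in> Hom C (case p of (i, j) \<Rightarrow> B i j) Y"
    for Y t
  proof -
    have "\<exists>u. u \<in> Hom C (A i) Y \<and> (\<forall>j\<in>K i. u \<cdot> y i j = t (i, j))" if i: "i \<in> I" for i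
    proof -
      have "t (i, j) \<in> Hom C (B i j) Y" if "j \<in> K i" for j using t[of "(i, j)"] i that by simp
      from coproduct_factor[OF B[OF i] Y this]
      obtain u where "u \<in> Hom C (A i) Y" "\<And>j. j \<in> K i \<Longrightarrow> u \<cdot> y i j = t (i, j)" by blast
      then show ?thesis by (intro exI[of _ u]) simp
    qed
    then obtain u where u: "\<And>i. i \<in> I \<Longrightarrow> u i \<in> Hom C (A i) Y"
      "\<And>i j. i \<in> I \<Longrightarrow> j \<in> K i \<Longrightarrow> u i \<cdot> y i j = t (i, j)" by metis
    from coproduct_factor[OF X Y u(1)]
    obtain h where h: "h \<in> Hom C X Y" "\<And>i. i \<in> I \<Longrightarrow> h \<cdot> x i = u i" by blast
    have "h \<cdot> (x i \<cdot> y i j) = t (i, j)" if "i \<in> I" "j \<in> K i" for i j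
      using comp_assoc[OF y[OF that] x[OF that(1)] h(1)] h(2)[OF that(1)] u(2)[OF that] by simp
    then show ?thesis using h(1) by auto
  qed
  show "h = k" if h: "h \<in> Hom C X Y" and k: "k \<in> Hom C X Y"
    and eq: "\<And>p. p \<in> Sigma I K \<Longrightarrow>
      h \<cdot> (case p of (i, j) \<Rightarrow> x i \<cdot> y i j) = k \<cdot> (case p of (i, j) \<Rightarrow> x i \<cdot> y i j)" for Y h k
  proof (rule coproduct_ext[OF X h k])
    fix i assume i: "i \<in> I"
    show "h \<cdot> x i = k \<cdot> x i"
    proof (rule coproduct_ext[OF B[OF i] comp_closed[OF x[OF i] h] comp_closed[OF x[OF i] k]])
      fix j assume j: "j \<in> K i"
      show "(h \<cdot> x i) \<cdot> y i j = (k \<cdot> x i) \<cdot> y i j"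
        using eq[of "(i, j)"] i j comp_assoc[OF y[OF i j] x[OF i] h]
          comp_assoc[OF y[OF i j] x[OF i] k] by simp
    qed
  qed
qed

lemma coproduct_singleton_id:
  assumes "X \<in> Obj C"
  shows "is_coproduct C {i} (\<lambda>_. X) X (\<lambda>_. Id C X)"
proof (rule is_coproductI)
  show "\<exists>h\<in>Hom C X Y. \<forall>j\<in>{i}. h \<cdot> Id C X = t j"
    if "\<And>j. j \<in> {i} \<Longrightarrow> t j \<in> Hom C X Y" for Y t
    using that[of i] id_right by auto
  show "h = k" if "h \<in> Hom C X Y" "k \<in> Hom C X Y" "\<And>j. j \<in> {i} \<Longrightarrow> h \<cdot> Id C X = k \<cdot> Id C X"
    for Y h k
    using that id_right by (metis singletonI)
qed (use assms id_closed in auto)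

text \<open>Any coproduct of the family without its summand \<open>A a\<close> can serve as the second summand of
  \<open>X\<close>. This is the step that reduces finite coproducts to binary ones.\<close>

lemma coproduct_insert_split:
  assumes a: "a \<notin> I" and X: "is_coproduct C (insert a I) A X x" and X': "is_coproduct C I A X' x'"
  obtains j where "is_binary_coproduct C (A a) X' X (x a) j" "\<And>i. i \<in> I \<Longrightarrow> j \<cdot> x' i = x i"
proof -
  have XO: "X \<in> Obj C" "X' \<in> Obj C" "A a \<in> Obj C" and x: "\<And>i. i \<in> insert a I \<Longrightarrow> x i \<in> Hom C (A i) X"
    and x': "\<And>i. i \<in> I \<Longrightarrow> x' i \<in> Hom C (A i) X'"
    using X X' unfolding is_coproduct_def by blast+
  from coproduct_factor[OF X' XO(1), of x] x
  obtain j where j: "j \<in> Hom C X' X" "\<And>i. i \<in> I \<Longrightarrow> j \<cdot> x' i = x i" by blast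
  have bin: "\<exists>!h. h \<in> Hom C X Q \<and> h \<cdot> x a = f \<and> h \<cdot> j = g"
    if Q: "Q \<in> Obj C" and f: "f \<in> Hom C (A a) Q" and g: "g \<in> Hom C X' Q" for Q f g
  proof -
    have hj: "(h \<cdot> j) \<cdot> x' i = h \<cdot> x i" if "h \<in> Hom C X Q" "i \<in> I" for h i
      using comp_assoc[OF x'[OF that(2)] j(1) that(1)] j(2)[OF that(2)] by simp
    have "(if i = a then f else g \<cdot> x' i) \<in> Hom C (A i) Q" if "i \<in> insert a I" for i
      using that f comp_closed[OF x' g] by auto
    from coproduct_factor[OF X Q this] obtain h where h: "h \<in> Hom C X Q"
      and hx: "\<And>i. i \<in> insert a I \<Longrightarrow> h \<cdot> x i = (if i = a then f else g \<cdot> x' i)" by blast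
    have "h \<cdot> j = g"
    proof (rule coproduct_ext[OF X' comp_closed[OF j(1) h] g])
      fix i assume i: "i \<in> I"
      then have "i \<noteq> a" using a by auto
      then show "(h \<cdot> j) \<cdot> x' i = g \<cdot> x' i" using hj[OF h i] hx[of i] i by simp
    qed
    moreover have "k = h" if k: "k \<in> Hom C X Q" "k \<cdot> x a = f" "k \<cdot> j = g" for k
    proof (rule coproduct_ext[OF X k(1) h])
      fix i assume "i \<in> insert a I"
      then show "k \<cdot> x i = h \<cdot> x i" using hx[of i] hj[OF k(1), of i] k by auto
    qed
    moreover have "h \<cdot> x a = f" using hx[of a] by simp
    ultimately show ?thesis using h by blast
  qed
  have "is_binary_coproduct C (A a) X' X (x a) j"
    unfolding is_binary_coproduct_iff using XO x[of a] j(1) bin by auto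
  then show ?thesis using that j(2) by blast
qed

lemma coproduct_insert:
  assumes a: "a \<notin> I" and P: "is_binary_coproduct C (A a) X' X k j" and X': "is_coproduct C I A X' x'"
  shows "is_coproduct C (insert a I) A X (\<lambda>i. if i = a then k else j \<cdot> x' i)"
proof (rule is_coproductI)
  have XO: "X \<in> Obj C" and k: "k \<in> Hom C (A a) X" and j: "j \<in> Hom C X' X"
    and bin: "\<And>Q f g. Q \<in> Obj C \<Longrightarrow> f \<in> Hom C (A a) Q \<Longrightarrow> g \<in> Hom C X' Q \<Longrightarrow>
      \<exists>!h. h \<in> Hom C X Q \<and> h \<cdot> k = f \<and> h \<cdot> j = g"
    using P unfolding is_binary_coproduct_iff by auto
  have x': "x' i \<in> Hom C (A i) X'" if "i \<in> I" for i using X' that by (simp add: is_coproduct_def)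
  let ?x = "\<lambda>i. if i = a then k else j \<cdot> x' i"
  show "X \<in> Obj C" by fact
  show "?x i \<in> Hom C (A i) X" if i: "i \<in> insert a I" for i
    using i k comp_closed[OF x'[of i] j] by (cases "i = a") simp_all
  have hj: "(h \<cdot> j) \<cdot> x' i = h \<cdot> ?x i" if "h \<in> Hom C X Y" "i \<in> I" for h i Y
  proof -
    have "i \<noteq> a" using a that(2) by auto
    then show ?thesis using comp_assoc[OF x'[OF that(2)] j that(1)] by simp
  qed
  show "\<exists>h\<in>Hom C X Y. \<forall>i\<in>insert a I. h \<cdot> ?x i = t i"
    if Y: "Y \<in> Obj C" and t: "\<And>i. i \<in> insert a I \<Longrightarrow> t i \<in> Hom C (A i) Y" for Y t
  proof -
    from coproduct_factor[OF X' Y, of t] t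
    obtain g where g: "g \<in> Hom C X' Y" "\<And>i. i \<in> I \<Longrightarrow> g \<cdot> x' i = t i" by blast
    from bin[OF Y t[of a] g(1)] obtain h where h: "h \<in> Hom C X Y" "h \<cdot> k = t a" "h \<cdot> j = g" by auto
    have "h \<cdot> ?x i = t i" if "i \<in> insert a I" for i
      using that hj[OF h(1), of i] h g(2)[of i] by (cases "i = a") auto
    then show ?thesis using h(1) by blast
  qed
  show "h = l" if h: "h \<in> Hom C X Y" and l: "l \<in> Hom C X Y"
    and eq: "\<And>i. i \<in> insert a I \<Longrightarrow> h \<cdot> ?x i = l \<cdot> ?x i" for Y h l
  proof -
    have "h \<cdot> j = l \<cdot> j"
    proof (rule coproduct_ext[OF X' comp_closed[OF j h] comp_closed[OF j l]])
      fix i assume i: "i \<in> I"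
      show "(h \<cdot> j) \<cdot> x' i = (l \<cdot> j) \<cdot> x' i" using hj[OF h i] hj[OF l i] eq[of i] i by simp
    qed
    moreover have "h \<cdot> k = l \<cdot> k" using eq[of a] by simp
    moreover have "Y \<in> Obj C" using h cod_closed by (auto simp: Hom_def)
    ultimately show ?thesis
      using bin[of Y "l \<cdot> k" "l \<cdot> j"] comp_closed[OF k l] comp_closed[OF j l] h l by blast
  qed
qed

end

section \<open>Universality of finite coproducts\<close>

context finitary_extensive
begin

text \<open>If \<open>0\<close> is initial then \<open>0\<close> is the coproduct \<open>0 + 0\<close> along identities. Pulling this back along
  \<open>f : Y \<rightarrow> 0\<close> exhibits \<open>Y\<close> as \<open>Y + Y\<close> along identities, which forces parallel maps out of \<open>Y\<close>
  to agree.\<close>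

lemma strict_initial:
  assumes Z: "is_coproduct C {} A Z x" and f: "f \<in> Hom C Y Z"
  shows "is_coproduct C {} B Y y"
proof (rule is_coproductI)
  have ZO: "Z \<in> Obj C" and YO: "Y \<in> Obj C"
    using Z f dom_closed by (auto simp: is_coproduct_def Hom_def)
  have idZ: "Id C Z \<in> Hom C Z Z" and idY: "Id C Y \<in> Hom C Y Y" using ZO YO id_closed by auto
  have "\<exists>!h. h \<in> Hom C Z Q \<and> h \<cdot> Id C Z = u \<and> h \<cdot> Id C Z = v"
    if uv: "u \<in> Hom C Z Q" "v \<in> Hom C Z Q" for Q u v
  proof -
    have "u = v" using coproduct_ext[OF Z uv] by simp
    then show ?thesis using uv id_right by (intro ex1I[of _ u]) auto
  qed
  then have PZ: "is_binary_coproduct C Z Z Z (Id C Z) (Id C Z)"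
    unfolding is_binary_coproduct_iff using ZO idZ by auto
  have pb: "is_pullback C (Id C Y) f f (Id C Z)"
    unfolding is_pullback_def
  proof (intro conjI ballI impI)
    fix T a b assume T: "a \<in> Hom C T (Dom C f)" "b \<in> Hom C T (Dom C (Id C Z))" "f \<cdot> a = Id C Z \<cdot> b"
    have a: "a \<in> Hom C T Y" and b: "b \<in> Hom C T Z" using T f idZ by (auto simp: Hom_def)
    have "Dom C (Id C Y) = Y" using idY by (simp add: Hom_def)
    moreover have "f \<cdot> a = b" using T(3) id_left[OF b] by simp
    ultimately show "\<exists>!h. h \<in> Hom C T (Dom C (Id C Y)) \<and> Id C Y \<cdot> h = a \<and> f \<cdot> h = b"
      using a by (metis id_left)
  qed (use f idY idZ id_left[OF f] id_right[OF f] in \<open>auto simp: Hom_def\<close>)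
  have eq: "f \<cdot> Id C Y = Id C Z \<cdot> f" using id_left[OF f] id_right[OF f] by simp
  have PY: "is_binary_coproduct C Y Y Y (Id C Y) (Id C Y)"
    using extensive[OF PZ idY idY f f f eq eq] pb by simp
  show "Y \<in> Obj C" by fact
  show "\<exists>h\<in>Hom C Y Q. \<forall>i\<in>{}. h \<cdot> y i = t i" if Q: "Q \<in> Obj C" for Q t
  proof -
    obtain g where "g \<in> Hom C Z Q" using coproduct_factor[OF Z Q] by blast
    then show ?thesis using comp_closed[OF f] by auto
  qed
  show "h = k" if h: "h \<in> Hom C Y Q" and k: "k \<in> Hom C Y Q" for Q h k
  proof -
    have "Q \<in> Obj C" using h cod_closed by (auto simp: Hom_def)
    then obtain l where "l \<in> Hom C Y Q" "l \<cdot> Id C Y = h" "l \<cdot> Id C Y = k"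
      using PY h k unfolding is_binary_coproduct_iff by meson
    then show ?thesis by simp
  qed
qed simp

lemma binary_coproduct_pullbacks:
  assumes P: "is_binary_coproduct C X Y P i j" and f: "f \<in> Hom C Z P"
  obtains Z1 Z2 z1 z2 f1 f2 where "is_binary_coproduct C Z1 Z2 Z z1 z2"
    "f1 \<in> Hom C Z1 X" "f2 \<in> Hom C Z2 Y" "f \<cdot> z1 = i \<cdot> f1" "f \<cdot> z2 = j \<cdot> f2"
proof -
  have ij: "i \<in> Hom C X P" "j \<in> Hom C Y P" using P unfolding is_binary_coproduct_iff by auto
  \<comment> \<open>Pullbacks are given along coprojections of families indexed by \<open>nat\<close>, hence the renumbering
     of \<open>True, False\<close> by \<open>0, 1\<close>.\<close>
  have bij: "bij_betw (\<lambda>n::nat. n = 0) {0, 1} UNIV"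
    by (auto simp: bij_betw_def inj_on_def UNIV_bool)
  note P' = coproduct_reindex[OF P[unfolded is_binary_coproduct_def] bij]
  have fA: "f \<in> Arr C" "Cod C f = P" "Dom C f = Z" using f by (auto simp: Hom_def)
  obtain z1 f1 where p1: "is_pullback C z1 f1 f i"
    using pullbacks_along_coprojections[OF _ P', of 0 f] fA by auto
  obtain z2 f2 where p2: "is_pullback C z2 f2 f j"
    using pullbacks_along_coprojections[OF _ P', of 1 f] fA by auto
  have z: "z1 \<in> Hom C (Dom C z1) Z" "z2 \<in> Hom C (Dom C z2) Z"
    "f1 \<in> Hom C (Dom C z1) X" "f2 \<in> Hom C (Dom C z2) Y" "f \<cdot> z1 = i \<cdot> f1" "f \<cdot> z2 = j \<cdot> f2"
    using p1 p2 fA ij by (auto simp: is_pullback_def Hom_def)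
  have "is_binary_coproduct C (Dom C z1) (Dom C z2) Z z1 z2"
    using extensive[OF P z(1,2,3) f z(4,5,6)] p1 p2 by simp
  then show ?thesis using that z by blast
qed

text \<open>Extensivity speaks of binary coproducts, so the proof peels off one summand at a time; the
  empty family is where strictness of the initial object is needed. Of the squares over
  the \<open>x i\<close> only commutativity is recorded: it says that \<open>f \<cdot> y i\<close> factors through \<open>x i\<close>, which is
  how membership in a sieve containing \<open>x i\<close> is detected.\<close>

lemma finite_coproducts_universal:
  fixes I :: "nat set"
  assumes "finite I" "is_coproduct C I A X x" "f \<in> Hom C Y X"
  shows "\<exists>B y g. is_coproduct C I B Y y \<and> (\<forall>i\<in>I. g i \<in> Hom C (B i) (A i) \<and> f \<cdot> y i = x i \<cdot> g i)"
  using assms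
proof (induction I arbitrary: X x f Y)
  case empty
  then show ?case using strict_initial by blast
next
  case (insert a I)
  have A: "\<forall>i\<in>I. A i \<in> Obj C" using insert.prems(1) by (simp add: is_coproduct_def)
  obtain X' x' where X': "is_coproduct C I A X' x'"
    using finite_coproducts[OF insert.hyps(1) A] by blast
  obtain j where j: "is_binary_coproduct C (A a) X' X (x a) j" "\<And>i. i \<in> I \<Longrightarrow> j \<cdot> x' i = x i"
    using coproduct_insert_split[OF insert.hyps(2) insert.prems(1) X'] by blast
  obtain Z1 Z2 z1 z2 f1 f2 where Z: "is_binary_coproduct C Z1 Z2 Y z1 z2"
    and f12: "f1 \<in> Hom C Z1 (A a)" "f2 \<in> Hom C Z2 X'" "f \<cdot> z1 = x a \<cdot> f1" "f \<cdot> z2 = j \<cdot> f2"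
    using binary_coproduct_pullbacks[OF j(1) insert.prems(2)] by blast
  obtain B y g where B: "is_coproduct C I B Z2 y"
    and g: "\<And>i. i \<in> I \<Longrightarrow> g i \<in> Hom C (B i) (A i)" "\<And>i. i \<in> I \<Longrightarrow> f2 \<cdot> y i = x' i \<cdot> g i"
    using insert.IH[OF X' f12(2)] by blast
  let ?B = "B(a := Z1)" and ?y = "\<lambda>i. if i = a then z1 else z2 \<cdot> y i" and ?g = "g(a := f1)"
  have ne: "i \<noteq> a" if "i \<in> I" for i using that insert.hyps(2) by auto
  have "is_coproduct C I ?B Z2 y"
    using B ne by (simp add: is_coproduct_def)
  then have "is_coproduct C (insert a I) ?B Y ?y"
    using coproduct_insert[OF insert.hyps(2), of ?B Z2 Y z1 z2 y] Z by simp
  moreover have "?g i \<in> Hom C (?B i) (A i) \<and> f \<cdot> ?y i = x i \<cdot> ?g i" if "i \<in> insert a I" for i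
  proof (cases "i = a")
    case False
    then have i: "i \<in> I" using that by simp
    have y: "y i \<in> Hom C (B i) Z2" and x': "x' i \<in> Hom C (A i) X'"
      using B X' i by (auto simp: is_coproduct_def)
    have z2: "z2 \<in> Hom C Z2 Y" and jj: "j \<in> Hom C X' X"
      using Z j(1) unfolding is_binary_coproduct_iff by auto
    have "f \<cdot> (z2 \<cdot> y i) = (f \<cdot> z2) \<cdot> y i" using comp_assoc[OF y z2 insert.prems(2)] by simp
    also have "\<dots> = j \<cdot> (f2 \<cdot> y i)" using comp_assoc[OF y f12(2) jj] f12(4) by simp
    also have "\<dots> = x i \<cdot> g i" using comp_assoc[OF g(1)[OF i] x' jj] g(2)[OF i] j(2)[OF i] by simp
    finally show ?thesis using False g(1)[OF i] by simp
  qed (use f12 in simp)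
  ultimately show ?case by blast
qed

end

section \<open>The topology of large sieves\<close>

definition large_sieve :: "('o, 'a) cat \<Rightarrow> 'o \<Rightarrow> 'a set \<Rightarrow> bool" where
  "large_sieve C X S \<longleftrightarrow> is_sieve C X S \<and>
     (\<exists>(I :: nat set) A x. finite I \<and> is_coproduct C I A X x \<and> x ` I \<subseteq> S)"

context finitary_extensive
begin

lemma large_sieve_pullback:
  assumes S: "large_sieve C (Cod C f) S" and f: "f \<in> Arr C"
  shows "large_sieve C (Dom C f) (pullback_sieve C f S)"
proof -
  obtain I :: "nat set" and A x where I: "finite I" "is_coproduct C I A (Cod C f) x" "x ` I \<subseteq> S"
    and sv: "is_sieve C (Cod C f) S"
    using S unfolding large_sieve_def by blast
  obtain B y g where y: "is_coproduct C I B (Dom C f) y"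
    and g: "\<And>i. i \<in> I \<Longrightarrow> g i \<in> Hom C (B i) (A i)" "\<And>i. i \<in> I \<Longrightarrow> f \<cdot> y i = x i \<cdot> g i"
    using finite_coproducts_universal[OF I(1,2), of f "Dom C f"] f by (auto simp: Hom_def)
  have "y i \<in> pullback_sieve C f S" if i: "i \<in> I" for i
  proof -
    have xy: "x i \<in> S" "Dom C (x i) = A i" "y i \<in> Arr C" "Cod C (y i) = Dom C f"
      using I y i by (auto simp: is_coproduct_def Hom_def)
    then have "x i \<cdot> g i \<in> S" using sv g(1)[OF i] by (auto simp: is_sieve_def Hom_def)
    then show ?thesis using xy g(2)[OF i] by (simp add: pullback_sieve_def)
  qed
  then show ?thesis
    unfolding large_sieve_def using is_sieve_pullback_sieve[OF f sv] I(1) y by blast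
qed

text \<open>Refining each summand of a coproduct contained in \<open>S\<close> by a coproduct whose composites lie in \<open>R\<close>
  gives a family indexed by pairs, which is renumbered to obtain indices in \<open>nat\<close>.\<close>

lemma large_sieve_transitive:
  assumes S: "large_sieve C X S" and R: "is_sieve C X R"
    and loc: "\<And>f. f \<in> S \<Longrightarrow> large_sieve C (Dom C f) (pullback_sieve C f R)"
  shows "large_sieve C X R"
proof -
  obtain I :: "nat set" and A x where I: "finite I" "is_coproduct C I A X x" "x ` I \<subseteq> S"
    using S unfolding large_sieve_def by blast
  have "\<exists>(K :: nat set) B y. finite K \<and> is_coproduct C K B (A i) y \<and> (\<forall>j\<in>K. x i \<cdot> y j \<in> R)"
    if i: "i \<in> I" for i
  proof -
    have "x i \<in> S" "Dom C (x i) = A i" using I i by (auto simp: is_coproduct_def Hom_def)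
    then show ?thesis using loc[of "x i"] unfolding large_sieve_def pullback_sieve_def by fastforce
  qed
  then obtain K :: "nat \<Rightarrow> nat set" and B y where K: "\<And>i. i \<in> I \<Longrightarrow> finite (K i)"
    "\<And>i. i \<in> I \<Longrightarrow> is_coproduct C (K i) (B i) (A i) (y i)"
    "\<And>i j. i \<in> I \<Longrightarrow> j \<in> K i \<Longrightarrow> x i \<cdot> y i j \<in> R"
    by metis
  have "finite (Sigma I K)" using I(1) K(1) by auto
  then obtain e where e: "bij_betw e {0..<card (Sigma I K)} (Sigma I K)"
    using ex_bij_betw_nat_finite by blast
  let ?x = "(\<lambda>(i, j). x i \<cdot> y i j) \<circ> e"
  have cop: "is_coproduct C {0..<card (Sigma I K)} ((\<lambda>(i, j). B i j) \<circ> e) X ?x"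
    by (rule coproduct_reindex[OF coproduct_of_coproducts[OF I(2) K(2)] e])
  have "?x ` {0..<card (Sigma I K)} = (\<lambda>(i, j). x i \<cdot> y i j) ` Sigma I K"
    using e by (simp only: image_comp[symmetric] bij_betw_imp_surj_on)
  then have "?x ` {0..<card (Sigma I K)} \<subseteq> R" using K(3) by auto
  then show ?thesis unfolding large_sieve_def using R cop by blast
qed

lemma large_sieves_topology:
  "is_grothendieck_topology C (\<lambda>X. {S. large_sieve C X S})"
  unfolding is_grothendieck_topology_def mem_Collect_eq
proof (intro conjI allI ballI impI; (unfold mem_Collect_eq)?)
  show "is_sieve C X S" if "large_sieve C X S" for X S using that by (simp add: large_sieve_def)
  show "large_sieve C X (max_sieve C X)" if X: "X \<in> Obj C" for X
  proof -
    have "(\<lambda>_. Id C X) ` {0::nat} \<subseteq> max_sieve C X"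
      using id_closed[OF X] by (simp add: max_sieve_def Hom_def)
    then show ?thesis
      unfolding large_sieve_def
      using is_sieve_max_sieve[OF X] coproduct_singleton_id[OF X, of "0::nat"] by blast
  qed
  show "large_sieve C (Dom C f) (pullback_sieve C f S)"
    if "f \<in> Arr C" "large_sieve C (Cod C f) S" for f S
    using that large_sieve_pullback by simp
  show "large_sieve C X R"
    if "large_sieve C X S"
      "is_sieve C X R \<and> (\<forall>f\<in>S. large_sieve C (Dom C f) (pullback_sieve C f R))" for X S R
    using that large_sieve_transitive by blast
qed

lemma large_sieves_cover_finite_coproducts:
  "covers_finite_coproducts C (\<lambda>X. {S. large_sieve C X S})"
  unfolding covers_finite_coproducts_def mem_Collect_eq
proof (intro allI impI)
  fix I :: "nat set" and A X x
  assume I: "finite I \<and> is_coproduct C I A X x"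
  then have x: "\<And>i. i \<in> I \<Longrightarrow> x i \<in> Hom C (A i) X" "X \<in> Obj C" "\<And>i. i \<in> I \<Longrightarrow> A i \<in> Obj C"
    by (auto simp: is_coproduct_def)
  have "x i \<in> generated_sieve C I x" if i: "i \<in> I" for i
  proof -
    have "x i = x i \<cdot> Id C (A i)" using id_right[OF x(1)[OF i]] by simp
    moreover have "Id C (A i) \<in> Arr C" "Cod C (Id C (A i)) = Dom C (x i)"
      using id_closed[OF x(3)[OF i]] x(1)[OF i] by (auto simp: Hom_def)
    ultimately show ?thesis using i unfolding generated_sieve_def by blast
  qed
  moreover have "is_sieve C X (generated_sieve C I x)"
    using is_sieve_generated_sieve[of X I x] x by (simp add: Hom_def)
  ultimately show "large_sieve C X (generated_sieve C I x)" unfolding large_sieve_def using I by blast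
qed

lemma extensive_topology_large:
  "S \<in> extensive_topology C X \<Longrightarrow> large_sieve C X S"
  using extensive_topology_least(3)[OF large_sieves_topology large_sieves_cover_finite_coproducts]
  by blast

section \<open>Representable presheaves are sheaves\<close>

lemma representable_is_presheaf:
  "is_presheaf C (representable C W)"
  unfolding is_presheaf_def representable_def psh.simps
proof (intro conjI ballI impI)
  show "s \<cdot> f \<in> Hom C (Dom C f) W" if "f \<in> Arr C" "s \<in> Hom C (Cod C f) W" for f s
    using that by (intro comp_closed[of f _ "Cod C f"]) (auto simp: Hom_def)
  show "s \<cdot> Id C X = s" if "s \<in> Hom C X W" for X s using that by (rule id_right)
  show "s \<cdot> (f \<cdot> g) = (s \<cdot> f) \<cdot> g"
    if "f \<in> Arr C" "g \<in> Arr C" "Cod C g = Dom C f" "s \<in> Hom C (Cod C f) W" for f g s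
    using that by (intro comp_assoc[symmetric, of g _ "Dom C f" f "Cod C f"]) (auto simp: Hom_def)
qed

text \<open>Gluing over the sieve generated by a coproduct is immediate. A large sieve \<open>S\<close> may contain
  maps \<open>f\<close> that factor through no summand, and for these universality provides a coproduct
  decomposition of the domain on which both \<open>t \<cdot> f\<close> and \<open>s f\<close> are known.\<close>

lemma large_sieve_unique_gluing:
  assumes W: "W \<in> Obj C" and S: "large_sieve C X S"
    and s: "\<And>f. f \<in> S \<Longrightarrow> s f \<in> Hom C (Dom C f) W"
    and match: "\<And>f g. f \<in> S \<Longrightarrow> g \<in> Arr C \<Longrightarrow> Cod C g = Dom C f \<Longrightarrow> s f \<cdot> g = s (f \<cdot> g)"
  shows "\<exists>!t. t \<in> Hom C X W \<and> (\<forall>f\<in>S. t \<cdot> f = s f)"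
proof -
  obtain I :: "nat set" and A x where I: "finite I" "is_coproduct C I A X x" "x ` I \<subseteq> S"
    and sv: "is_sieve C X S"
    using S unfolding large_sieve_def by blast
  have x: "x i \<in> Hom C (A i) X" "x i \<in> S" "Dom C (x i) = A i" if "i \<in> I" for i
    using I that by (auto simp: is_coproduct_def Hom_def)
  have "s (x i) \<in> Hom C (A i) W" if "i \<in> I" for i using s[OF x(2)[OF that]] x(3)[OF that] by simp
  from coproduct_factor[OF I(2) W this]
  obtain t where t: "t \<in> Hom C X W" "\<And>i. i \<in> I \<Longrightarrow> t \<cdot> x i = s (x i)" by blast
  have tf: "t \<cdot> f = s f" if fS: "f \<in> S" for f
  proof -
    have f: "f \<in> Hom C (Dom C f) X" using sv fS by (auto simp: is_sieve_def Hom_def)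
    obtain B y g where y: "is_coproduct C I B (Dom C f) y"
      and g: "\<And>i. i \<in> I \<Longrightarrow> g i \<in> Hom C (B i) (A i)" "\<And>i. i \<in> I \<Longrightarrow> f \<cdot> y i = x i \<cdot> g i"
      using finite_coproducts_universal[OF I(1,2) f] by blast
    show ?thesis
    proof (rule coproduct_ext[OF y comp_closed[OF f t(1)] s[OF fS]])
      fix i assume i: "i \<in> I"
      have yi: "y i \<in> Hom C (B i) (Dom C f)" using y i by (simp add: is_coproduct_def)
      have "(t \<cdot> f) \<cdot> y i = t \<cdot> (x i \<cdot> g i)" using comp_assoc[OF yi f t(1)] g(2)[OF i] by simp
      also have "\<dots> = s (x i) \<cdot> g i"
        using comp_assoc[OF g(1)[OF i] x(1)[OF i] t(1)] t(2)[OF i] by simp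
      also have "\<dots> = s (f \<cdot> y i)"
        using match[OF x(2)[OF i], of "g i"] g[OF i] x(3)[OF i] by (simp add: Hom_def)
      also have "\<dots> = s f \<cdot> y i" using match[OF fS, of "y i"] yi by (simp add: Hom_def)
      finally show "(t \<cdot> f) \<cdot> y i = s f \<cdot> y i" .
    qed
  qed
  show ?thesis
  proof (rule ex1I[of _ t])
    fix u assume u: "u \<in> Hom C X W \<and> (\<forall>f\<in>S. u \<cdot> f = s f)"
    show "u = t" using coproduct_ext[OF I(2), of u W t] u t x(2) by simp
  qed (use t tf in blast)
qed

end

theorem proposition6p6:
  fixes C :: "('o, 'a) cat"
  assumes "finitary_extensive C"
  shows "subcanonical C (extensive_topology C)"
proof -
  interpret finitary_extensive C by fact
  show ?thesis
    unfolding subcanonical_def is_sheaf_def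
  proof (intro ballI conjI allI impI)
    fix W show "is_presheaf C (representable C W)" by (rule representable_is_presheaf)
  next
    fix W X S s
    assume W: "W \<in> Obj C" and S: "S \<in> extensive_topology C X"
      and s: "is_matching_family C (representable C W) S s"
    show "\<exists>!t. t \<in> Sec (representable C W) X \<and> (\<forall>f\<in>S. Res (representable C W) f t = s f)"
      using large_sieve_unique_gluing[OF W extensive_topology_large[OF S], of s] s
      by (simp add: is_matching_family_def representable_def)
  qed
qed

end
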